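(* Let $G$ be a connected graph of order $n\geq 2$ and $p$ an integer with $1\le p\le \frac{n}{2}-1$. Then $$\left\lceil\frac{2(n+p)}{3}\right\rceil\le \gamma_t(M(G+\overline{K_p}))\le 2p+\min\{\gamma_t(M(G[A])) : A\subseteq V(G),\ |A|=n-2p,\ G[A] \text{ has no isolated vertices}\}.$$
   Context: All graphs are finite and simple. $G[A]$ is the subgraph of $G$ induced on $A$. $\overline{K_p}$ denotes the edgeless graph on $p$ vertices. The join $G+H$ of graphs $G,H$ (on disjoint vertex sets) has vertex set $V(G)\cup V(H)$ and edge set $E(G)\cup E(H)\cup\{vw : v\in V(G), w\in V(H)\}$. For a graph $H$ with no isolated vertices, a total dominating set of $H$ is a set $S\subseteq V(H)$ such that every vertex of $H$ has at least one neighbor in $S$; $\gamma_t(H)$ is the minimum cardinality of a total dominating set. The middle graph $M(G)$ of a graph $G$ has vertex set $V(G)\cup E(G)$ (disjoint union), and two of its vertices $x,y$ are adjacent exactly when either $x,y\in E(G)$ are edges of $G$ sharing a common endpoint, or $x\in V(G)$, $y\in E(G)$ and $x$ is an endpoint of $y$ (no two elements of $V(G)$ are adjacent in $M(G)$). *)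

theory Defs
  imports Complex_Main
begin

record 'a graph =
  verts :: "'a set"
  edges :: "'a set set"

definition simple_graph :: "'a graph \<Rightarrow> bool" where
  "simple_graph G \<longleftrightarrow>
     finite (verts G) \<and> (\<forall>e \<in> edges G. e \<subseteq> verts G \<and> card e = 2)"

definition connected_graph :: "'a graph \<Rightarrow> bool" where
  "connected_graph G \<longleftrightarrow> verts G \<noteq> {} \<and>
     (\<forall>u \<in> verts G. \<forall>v \<in> verts G. (u, v) \<in> {(x, y). {x, y} \<in> edges G}\<^sup>*)"

definition no_isolated_vertices :: "'a graph \<Rightarrow> bool" where
  "no_isolated_vertices G \<longleftrightarrow> (\<forall>v \<in> verts G. \<exists>u \<in> verts G. {u, v} \<in> edges G)"

definition induced_subgraph :: "'a graph \<Rightarrow> 'a set \<Rightarrow> 'a graph" where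
  "induced_subgraph G A = \<lparr> verts = A, edges = {e \<in> edges G. e \<subseteq> A} \<rparr>"

definition edgeless_graph :: "nat \<Rightarrow> nat graph" where
  "edgeless_graph p = \<lparr> verts = {..<p}, edges = {} \<rparr>"

text \<open>The sum type makes the two vertex sets of a join disjoint.\<close>

definition graph_join :: "'a graph \<Rightarrow> 'b graph \<Rightarrow> ('a + 'b) graph" where
  "graph_join G H =
     \<lparr> verts = Inl ` verts G \<union> Inr ` verts H,
       edges = (\<lambda>e. Inl ` e) ` edges G \<union> (\<lambda>e. Inr ` e) ` edges H
             \<union> {{Inl v, Inr w} | v w. v \<in> verts G \<and> w \<in> verts H} \<rparr>"

text \<open>In the middle graph, \<open>Inl v\<close> is the vertex \<open>v\<close> of \<open>G\<close> and \<open>Inr e\<close> the edge \<open>e\<close> of \<open>G\<close>.\<close>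

definition middle_graph :: "'a graph \<Rightarrow> ('a + 'a set) graph" where
  "middle_graph G =
     \<lparr> verts = Inl ` verts G \<union> Inr ` edges G,
       edges = {{Inr e, Inr f} | e f. e \<in> edges G \<and> f \<in> edges G \<and> e \<noteq> f \<and> e \<inter> f \<noteq> {}}
             \<union> {{Inl v, Inr e} | v e. v \<in> verts G \<and> e \<in> edges G \<and> v \<in> e} \<rparr>"

definition total_dominating_set :: "'a graph \<Rightarrow> 'a set \<Rightarrow> bool" where
  "total_dominating_set G S \<longleftrightarrow>
     S \<subseteq> verts G \<and> (\<forall>v \<in> verts G. \<exists>u \<in> S. {u, v} \<in> edges G)"

text \<open>Meaningful only for finite graphs without isolated vertices: only then is the
  set of cardinalities below finite and nonempty.\<close>

definition total_domination_number :: "'a graph \<Rightarrow> nat" where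
  "total_domination_number G = Min (card ` {S. total_dominating_set G S})"

lemma no_isolated_vertices_iff:
  "no_isolated_vertices G \<longleftrightarrow> (\<exists>S. total_dominating_set G S)"
  unfolding no_isolated_vertices_def total_dominating_set_def by blast

lemma finite_total_dominating_sets:
  assumes "simple_graph G"
  shows "finite {S. total_dominating_set G S}"
  using assms unfolding simple_graph_def total_dominating_set_def
  by (auto intro: finite_subset[of _ "Pow (verts G)"])

lemma total_domination_number_attained:
  assumes "simple_graph G" "no_isolated_vertices G"
  shows "\<exists>S. total_dominating_set G S \<and> card S = total_domination_number G"
proof -
  have "Min (card ` {S. total_dominating_set G S}) \<in> card ` {S. total_dominating_set G S}"
    using finite_total_dominating_sets[OF assms(1)] assms(2)[unfolded no_isolated_vertices_iff]
    by (intro Min_in) simp_all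
  then show ?thesis
    unfolding total_domination_number_def by auto
qed

lemma total_domination_number_le:
  assumes "simple_graph G" "total_dominating_set G S"
  shows "total_domination_number G \<le> card S"
  unfolding total_domination_number_def
  using assms finite_total_dominating_sets by (intro Min_le) auto

lemma simple_graph_induced_subgraph:
  assumes "simple_graph G" "A \<subseteq> verts G"
  shows "simple_graph (induced_subgraph G A)"
  using assms unfolding simple_graph_def induced_subgraph_def by (auto intro: finite_subset)

lemma simple_graph_join:
  assumes "simple_graph G" "simple_graph H"
  shows "simple_graph (graph_join G H)"
  using assms unfolding simple_graph_def graph_join_def
  by (simp add: ball_Un) (safe; force simp: card_image)

lemma simple_graph_edgeless: "simple_graph (edgeless_graph p)"
  by (simp add: simple_graph_def edgeless_graph_def)

lemma simple_graph_middle_graph: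
  assumes "simple_graph G"
  shows "simple_graph (middle_graph G)"
proof -
  have "finite (edges G)"
    using assms unfolding simple_graph_def by (auto intro: finite_subset[of _ "Pow (verts G)"])
  with assms show ?thesis
    unfolding simple_graph_def middle_graph_def by (auto simp: card_2_iff)
qed

lemma no_isolated_vertices_middle_graph:
  assumes "simple_graph G" "no_isolated_vertices G"
  shows "no_isolated_vertices (middle_graph G)"
  unfolding no_isolated_vertices_def
proof
  fix x assume "x \<in> verts (middle_graph G)"
  then consider (v) v where "x = Inl v" "v \<in> verts G" | (e) e where "x = Inr e" "e \<in> edges G"
    unfolding middle_graph_def by auto
  then have "\<exists>y \<in> verts (middle_graph G). {x, y} \<in> edges (middle_graph G)"
  proof cases
    case v
    then obtain u where "{u, v} \<in> edges G"
      using assms unfolding no_isolated_vertices_def by metis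
    with v have "Inr {u, v} \<in> verts (middle_graph G)"
      and "{x, Inr {u, v}} \<in> edges (middle_graph G)"
      unfolding middle_graph_def by auto
    then show ?thesis by (rule bexI[rotated])
  next
    case e
    then have "e \<subseteq> verts G" "e \<noteq> {}"
      using assms(1) unfolding simple_graph_def by auto
    then obtain v where "v \<in> e" "v \<in> verts G"
      by auto
    with e have "Inl v \<in> verts (middle_graph G)"
      and "{Inl v, x} \<in> edges (middle_graph G)"
      unfolding middle_graph_def by auto
    then have "{x, Inl v} \<in> edges (middle_graph G)"
      by (simp only: insert_commute)
    with \<open>Inl v \<in> verts (middle_graph G)\<close> show ?thesis by (rule bexI[rotated])
  qed
  then show "\<exists>u \<in> verts (middle_graph G). {u, x} \<in> edges (middle_graph G)"
    by (simp only: insert_commute)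
qed

end

theory Submission
  imports Defs
begin

text \<open>A total dominating set \<open>S\<close> of \<open>M(H)\<close> consists of a set \<open>F\<close> of edges covering all vertices of
  \<open>H\<close>, and a set \<open>X\<close> of vertices; every edge in \<open>F\<close> meets \<open>X\<close> or another edge in \<open>F\<close>. Growing \<open>F\<close>
  by one edge meeting the part already built, by a disjoint edge meeting \<open>X\<close>, or by a pair of
  intersecting edges, never adds more than \<open>3/2\<close> vertices of \<open>H\<close> per element of \<open>S\<close>. This is the lower
  bound. For the upper bound, add to a total dominating set of \<open>M(G[A])\<close> one edge for each of the
  \<open>2p\<close> vertices outside \<open>A\<close>, joining it to a new vertex so that each new vertex is used exactly twice.\<close>

section \<open>Adjacency and total domination in the middle graph\<close>

lemma middle_graph_edge_simps [simp]:
  "{Inr e, Inr f} \<in> edges (middle_graph H) \<longleftrightarrow>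
     e \<in> edges H \<and> f \<in> edges H \<and> e \<noteq> f \<and> e \<inter> f \<noteq> {}"
  "{Inl v, Inr e} \<in> edges (middle_graph H) \<longleftrightarrow> v \<in> verts H \<and> e \<in> edges H \<and> v \<in> e"
  "{Inr e, Inl v} \<in> edges (middle_graph H) \<longleftrightarrow> v \<in> verts H \<and> e \<in> edges H \<and> v \<in> e"
  "{Inl u, Inl v} \<notin> edges (middle_graph H)"
  unfolding middle_graph_def by (auto simp: doubleton_eq_iff)

lemma middle_graph_verts_simps [simp]:
  "Inl v \<in> verts (middle_graph H) \<longleftrightarrow> v \<in> verts H"
  "Inr e \<in> verts (middle_graph H) \<longleftrightarrow> e \<in> edges H"
  unfolding middle_graph_def by auto

text \<open>No two vertices of H are adjacent in M(H), so only edges can dominate them; an edge can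
  be dominated by an endpoint or by another edge meeting it. Splitting \<open>S\<close> by type lets
  both bounds argue about vertices and edges of H directly.\<close>

lemma total_dominating_set_middle_graph_iff:
  assumes "simple_graph H"
  shows "total_dominating_set (middle_graph H) S \<longleftrightarrow>
    S \<subseteq> verts (middle_graph H) \<and>
    (\<forall>v \<in> verts H. \<exists>f. Inr f \<in> S \<and> v \<in> f) \<and>
    (\<forall>e \<in> edges H. (\<exists>v \<in> e. Inl v \<in> S) \<or> (\<exists>f. Inr f \<in> S \<and> f \<noteq> e \<and> f \<inter> e \<noteq> {}))"
    (is "_ \<longleftrightarrow> ?sub \<and> ?V \<and> ?E")
proof -
  have verts: "verts (middle_graph H) = Inl ` verts H \<union> Inr ` edges H"
    by (simp add: middle_graph_def)
  have sum: "(\<exists>u \<in> S. P u) \<longleftrightarrow> (\<exists>v. Inl v \<in> S \<and> P (Inl v)) \<or> (\<exists>f. Inr f \<in> S \<and> P (Inr f))" for P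
    by (metis sum.exhaust)
  have "(\<exists>u \<in> S. {u, Inl v} \<in> edges (middle_graph H)) \<longleftrightarrow> (\<exists>f. Inr f \<in> S \<and> v \<in> f)"
    if "?sub" "v \<in> verts H" for v
    using that by (auto simp: sum verts)
  moreover have "(\<exists>u \<in> S. {u, Inr e} \<in> edges (middle_graph H)) \<longleftrightarrow>
      (\<exists>v \<in> e. Inl v \<in> S) \<or> (\<exists>f. Inr f \<in> S \<and> f \<noteq> e \<and> f \<inter> e \<noteq> {})"
    if "?sub" "e \<in> edges H" for e
    unfolding sum middle_graph_edge_simps using that by (auto simp: verts)
  ultimately show ?thesis
    unfolding total_dominating_set_def verts ball_Un ball_simps(9) by (simp cong: conj_cong)
qed

section \<open>Counting argument for the lower bound\<close>

text \<open>Greedy growth phrased as maximality: a maximal subfamily satisfying the inequality must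
  be all of \<open>F\<close>, because a missing edge would allow an enlargement that preserves it. A
  point of \<open>X\<close> is counted only once it is covered, so it is still available to pay for
  a disjoint edge through it.\<close>

lemma card_Union_le_three_halves:
  fixes F :: "'a set set"
  assumes fin: "finite F" "finite X"
    and card2: "\<And>e. e \<in> F \<Longrightarrow> card e = 2"
    and meets: "\<And>e. e \<in> F \<Longrightarrow> e \<inter> X \<noteq> {} \<or> (\<exists>f \<in> F. f \<noteq> e \<and> f \<inter> e \<noteq> {})"
  shows "2 * card (\<Union>F) \<le> 3 * (card F + card (X \<inter> \<Union>F))"
proof -
  define good where "good F' \<longleftrightarrow> 2 * card (\<Union>F') \<le> 3 * (card F' + card (X \<inter> \<Union>F'))" for F'
  have "finite {F'. F' \<subseteq> F \<and> good F'}" "{} \<in> {F'. F' \<subseteq> F \<and> good F'}"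
    using fin by (auto simp: good_def)
  then obtain F' where F': "F' \<subseteq> F" "good F'"
    and maximal: "\<And>F''. F'' \<subseteq> F \<Longrightarrow> good F'' \<Longrightarrow> F' \<subseteq> F'' \<Longrightarrow> F'' = F'"
    using finite_has_maximal[of "{F'. F' \<subseteq> F \<and> good F'}"]
    by (metis (no_types, lifting) empty_iff mem_Collect_eq)
  have fine: "finite e" if "e \<in> F" for e
    using card2[OF that] by (metis card.infinite zero_neq_numeral)
  have finF': "finite F'" "finite (\<Union>F')"
    using F' fin fine by (auto intro: finite_subset)
  have "e \<in> F'" if eF: "e \<in> F" for e
  proof (rule ccontr)
    assume e: "e \<notin> F'"
    \<comment> \<open>All three cardinalities are additive when only the points outside
      \<open>\<Union>F'\<close> are counted for \<open>D\<close>. So if the increments satisfy the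
      inequality, \<open>F' \<union> D\<close> is good, against maximality.\<close>
    have grow: False if "D \<subseteq> F" "D \<noteq> {}" "D \<inter> F' = {}"
      "2 * card (\<Union>D - \<Union>F') \<le> 3 * (card D + card (X \<inter> \<Union>D - \<Union>F'))" for D
    proof -
      have D: "finite D" "finite (\<Union>D)"
        using that(1) fin fine by (auto intro: finite_subset)
      have "\<Union>(F' \<union> D) = \<Union>F' \<union> (\<Union>D - \<Union>F')"
        by blast
      then have U: "card (\<Union>(F' \<union> D)) = card (\<Union>F') + card (\<Union>D - \<Union>F')"
        using D finF' by (simp only:) (intro card_Un_disjoint; auto)
      have "X \<inter> \<Union>(F' \<union> D) = (X \<inter> \<Union>F') \<union> (X \<inter> \<Union>D - \<Union>F')"
        by blast
      then have X: "card (X \<inter> \<Union>(F' \<union> D)) = card (X \<inter> \<Union>F') + card (X \<inter> \<Union>D - \<Union>F')"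
        using fin by (simp only:) (intro card_Un_disjoint; auto)
      have FD: "card (F' \<union> D) = card F' + card D"
        using D finF' that(3) by (intro card_Un_disjoint) auto
      have "good (F' \<union> D)"
        using add_mono[OF F'(2)[unfolded good_def] that(4)]
        unfolding good_def U X FD by (simp only: distrib_left add_ac)
      then have "F' \<union> D = F'"
        using maximal[of "F' \<union> D"] F'(1) that(1) by blast
      then show False
        using that(2,3) by blast
    qed
    consider (old) "e \<inter> \<Union>F' \<noteq> {}" | (new) "e \<inter> \<Union>F' = {}" "e \<inter> X \<noteq> {}"
      | (pair) f where "e \<inter> \<Union>F' = {}" "f \<in> F" "f \<noteq> e" "f \<inter> e \<noteq> {}"
      using meets[OF eF] by blast
    then show False
    proof cases
      case old
      \<comment> \<open>At most one endpoint is new, and \<open>2 * 1 \<le> 3 * 1\<close>.\<close>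
      then have "e - \<Union>F' \<subset> e"
        by blast
      then have "card (e - \<Union>F') < 2"
        using psubset_card_mono[OF fine[OF eF]] card2[OF eF] by metis
      then show False
        using grow[of "{e}"] e eF by simp
    next
      case new
      \<comment> \<open>Two new points, paid for by \<open>e\<close> and by a newly covered point of
        \<open>X\<close>: \<open>2 * 2 \<le> 3 * 2\<close>.\<close>
      then have "X \<inter> e - \<Union>F' = X \<inter> e" "e - \<Union>F' = e"
        by blast+
      moreover have "0 < card (X \<inter> e)"
        using new fin by (auto simp: card_gt_0_iff)
      ultimately show False
        using grow[of "{e}"] e eF card2 by simp
    next
      case (pair f)
      \<comment> \<open>Two edges with a common point span at most three points:
        \<open>2 * 3 \<le> 3 * 2\<close>. This case can be tight and accounts for the ratio
        3/2.\<close>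
      have "card (e \<union> f) + card (e \<inter> f) = card e + card f"
        using card_Un_Int[of e f] fine eF pair(2) by metis
      moreover have "0 < card (e \<inter> f)"
        using pair(4) fine[OF eF] by (auto simp: card_gt_0_iff)
      ultimately have "card (e \<union> f) \<le> 3"
        using card2 eF pair(2) by simp
      moreover have "card (e \<union> f - \<Union>F') \<le> card (e \<union> f)"
        using fine eF pair(2) by (intro card_mono) auto
      \<comment> \<open>\<open>f\<close> meets \<open>e\<close>, which avoids
        \<open>\<Union>F'\<close>; hence two edges are really added.\<close>
      moreover have "f \<notin> F'"
        using pair by blast
      ultimately show False
        using grow[of "{e, f}"] e eF pair(2,3) by auto
    qed
  qed
  then have "F' = F"
    using F'(1) by blast
  then show ?thesis
    using F'(2) by (simp add: good_def)
qed

text \<open>With \<open>F\<close> and \<open>X\<close> the edge part and the vertex part of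
  \<open>S\<close>, domination of the vertices gives \<open>\<Union>F = verts H\<close>, and
  domination of the edges in \<open>F\<close> gives the meeting condition of the counting
  lemma.\<close>

lemma card_total_dominating_set_middle_graph_ge:
  assumes H: "simple_graph H" and S: "total_dominating_set (middle_graph H) S"
  shows "2 * card (verts H) \<le> 3 * card S"
proof -
  define F where "F = Inr -` S"
  define X where "X = Inl -` S"
  note dom = S[unfolded total_dominating_set_middle_graph_iff[OF H]]
  have sub: "F \<subseteq> edges H" "X \<subseteq> verts H"
    using dom by (auto simp: F_def X_def dest: subsetD)
  have fin: "finite S"
    using dom simple_graph_middle_graph[OF H] finite_subset unfolding simple_graph_def by blast
  then have finFX: "finite F" "finite X"
    by (auto simp: F_def X_def intro: finite_vimageI)
  have "S = Inl ` X \<union> Inr ` F"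
    unfolding F_def X_def by (auto simp: image_iff) (metis sum.exhaust)
  then have cardS: "card S = card X + card F"
    using finFX by (simp only:) (subst card_Un_disjoint; auto simp: card_image)
  have edge: "e \<subseteq> verts H" "card e = 2" if "e \<in> F" for e
    using that sub H unfolding simple_graph_def by auto
  have "\<Union>F = verts H"
    using dom edge by (fastforce simp: F_def)
  moreover have "2 * card (\<Union>F) \<le> 3 * (card F + card (X \<inter> \<Union>F))"
    using finFX edge(2)
  proof (rule card_Union_le_three_halves)
    fix e assume "e \<in> F"
    then have "e \<in> edges H"
      using sub by blast
    then show "e \<inter> X \<noteq> {} \<or> (\<exists>f \<in> F. f \<noteq> e \<and> f \<inter> e \<noteq> {})"
      using dom by (fastforce simp: F_def X_def)
  qed
  moreover have "X \<inter> verts H = X"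
    using sub by blast
  ultimately show ?thesis
    using cardS by simp
qed

section \<open>Vertex subsets of a connected graph\<close>

text \<open>A path from a point of \<open>A\<close> to a point outside has to leave \<open>A\<close>
  somewhere: without a crossing edge, everything reachable from \<open>a\<close> would stay in
  \<open>A\<close>.\<close>

lemma connected_graph_crossing_edge:
  assumes "simple_graph G" "connected_graph G" "A \<subset> verts G" "A \<noteq> {}"
  shows "\<exists>u \<in> A. \<exists>v \<in> verts G - A. {u, v} \<in> edges G"
proof (rule ccontr)
  assume no: "\<not> ?thesis"
  obtain a b where a: "a \<in> A" and b: "b \<in> verts G - A"
    using assms(3,4) by blast
  have "(a, b) \<in> {(x, y). {x, y} \<in> edges G}\<^sup>*"
    using assms(2,3) a b unfolding connected_graph_def by blast
  then have "b \<in> A"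
  proof (induction rule: rtrancl_induct)
    case base
    show ?case by (fact a)
  next
    case (step y z)
    then have "{y, z} \<in> edges G" "z \<in> verts G"
      using assms(1) unfolding simple_graph_def by auto
    then show ?case
      using no step.IH by blast
  qed
  then show False
    using b by blast
qed

text \<open>Start with an edge and keep adding the outer end of a crossing edge, which has a
  neighbour in the old set. This makes the minimum in the upper bound range over a nonempty set. The
  induction starts at 2, since a single vertex is isolated.\<close>

lemma connected_graph_subset_no_isolated:
  assumes G: "simple_graph G" "connected_graph G" and "2 \<le> k" "k \<le> card (verts G)"
  shows "\<exists>A \<subseteq> verts G. card A = k \<and> no_isolated_vertices (induced_subgraph G A)"
  using assms(3,4)
proof (induction k rule: dec_induct)
  case base
  obtain a where a: "a \<in> verts G"
    using G(2) unfolding connected_graph_def by blast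
  moreover have "card {a} \<noteq> card (verts G)"
    using base by simp
  then have "{a} \<noteq> verts G"
    by metis
  ultimately obtain v where "v \<in> verts G" "v \<noteq> a" "{a, v} \<in> edges G"
    using connected_graph_crossing_edge[OF G, of "{a}"] by blast
  with a show ?case
    by (intro exI[of _ "{a, v}"])
      (auto simp: no_isolated_vertices_def induced_subgraph_def insert_commute)
next
  case (step k)
  then obtain A where A: "A \<subseteq> verts G" "card A = k" "no_isolated_vertices (induced_subgraph G A)"
    by auto
  then have "A \<noteq> verts G" "A \<noteq> {}"
    using step by auto
  then obtain u v where uv: "u \<in> A" "v \<in> verts G - A" "{u, v} \<in> edges G"
    using connected_graph_crossing_edge[OF G, of A] A(1) by blast
  have "finite A"
    using A(1) G(1) finite_subset unfolding simple_graph_def by blast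
  moreover have "no_isolated_vertices (induced_subgraph G (insert v A))"
    using A(3) uv by (auto simp: no_isolated_vertices_def induced_subgraph_def)
  ultimately show ?case
    using A uv by (intro exI[of _ "insert v A"]) auto
qed

section \<open>Joins and the construction for the upper bound\<close>

lemma no_isolated_vertices_graph_join:
  assumes "verts G \<noteq> {}" "verts H \<noteq> {}"
  shows "no_isolated_vertices (graph_join G H)"
proof -
  have edge: "{Inl v, Inr w} \<in> edges (graph_join G H)" if "v \<in> verts G" "w \<in> verts H" for v w
    using that by (auto simp: graph_join_def)
  have verts: "verts (graph_join G H) = Inl ` verts G \<union> Inr ` verts H"
    by (simp add: graph_join_def)
  obtain a b where ab: "a \<in> verts G" "b \<in> verts H"
    using assms by blast
  show ?thesis
    unfolding no_isolated_vertices_def verts ball_Un bex_Un ball_simps(9) bex_simps(7)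
    using edge[OF _ ab(2)] edge[OF ab(1)] ab by (auto simp: insert_commute)
qed

lemma card_verts_graph_join:
  assumes "finite (verts G)" "finite (verts H)"
  shows "card (verts (graph_join G H)) = card (verts G) + card (verts H)"
  using assms by (simp add: graph_join_def) (subst card_Un_disjoint; auto simp: card_image)

text \<open>Edges of G inside \<open>A\<close> inherit their dominator from \<open>S\<close>. An
  edge of G with an endpoint \<open>v\<close> outside \<open>A\<close> meets the added edge
  \<open>t v\<close>. An edge at a new vertex meets two added edges there, at least one of which
  differs from it; this covers the added edges themselves.\<close>

lemma total_domination_number_join_edgeless_le:
  assumes G: "simple_graph G" and A: "A \<subseteq> verts G" "no_isolated_vertices (induced_subgraph G A)"
    and B: "card (verts G - A) = 2 * p"
  shows "total_domination_number (middle_graph (graph_join G (edgeless_graph p)))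
    \<le> 2 * p + total_domination_number (middle_graph (induced_subgraph G A))"
proof -
  let ?J = "graph_join G (edgeless_graph p)" and ?GA = "induced_subgraph G A"
  let ?B = "verts G - A"
  have GA: "simple_graph ?GA" and J: "simple_graph ?J"
    using simple_graph_induced_subgraph[OF G A(1)] simple_graph_join[OF G simple_graph_edgeless] .
  obtain S where S: "total_dominating_set (middle_graph ?GA) S"
    and cardS: "card S = total_domination_number (middle_graph ?GA)"
    using total_domination_number_attained[OF simple_graph_middle_graph[OF GA]
        no_isolated_vertices_middle_graph[OF GA A(2)]] by blast
  note dom = S[unfolded total_dominating_set_middle_graph_iff[OF GA]]
  have finB: "finite ?B"
    using G unfolding simple_graph_def by blast
  then obtain g where g: "bij_betw g ?B {..<2 * p}"
    using ex_bij_betw_finite_nat[of ?B] B by (auto simp: atLeast0LessThan)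
  \<comment> \<open>Numbering the \<open>2 * p\<close> outside vertices and reducing modulo
    \<open>p\<close> pairs the numbers \<open>i\<close> and \<open>i + p\<close> at the new vertex
    \<open>i\<close>.\<close>
  define t where "t v = {Inl v, Inr (g v mod p)}" for v
  \<comment> \<open>The embedding of M(G[A]) into the middle graph of the join: vertices and edges
    of G are renamed along \<open>Inl\<close>.\<close>
  define lift :: "'a + 'a set \<Rightarrow> ('a + nat) + ('a + nat) set"
    where "lift = map_sum Inl ((`) Inl)"
  define T where "T = lift ` S \<union> (\<lambda>v. Inr (t v)) ` ?B"
  have memT [simp]: "Inl (Inl v) \<in> T \<longleftrightarrow> Inl v \<in> S"
    "Inr (Inl ` f) \<in> T \<longleftrightarrow> Inr f \<in> S" for v f
  proof -
    show "Inl (Inl v) \<in> T \<longleftrightarrow> Inl v \<in> S"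
      unfolding T_def lift_def image_iff Un_iff
      by (metis map_sum.simps(1) map_sum.simps(2) sum.inject(1) sum.distinct(1) sum.exhaust)
    \<comment> \<open>\<open>t v\<close> contains a new vertex, so the added edges are never
      confused with lifted ones.\<close>
    have "Inl ` f \<noteq> t v" for v
      by (auto simp: t_def)
    then have "Inr (Inl ` f) \<in> T \<longleftrightarrow> Inr (Inl ` f) \<in> lift ` S"
      unfolding T_def by (simp add: image_iff)
    also have "\<dots> \<longleftrightarrow> Inr f \<in> S"
      unfolding lift_def image_iff
      by (metis map_sum.simps(1) map_sum.simps(2) sum.inject(2) sum.distinct(1) sum.exhaust
          inj_image_eq_iff[OF inj_Inl])
    finally show "Inr (Inl ` f) \<in> T \<longleftrightarrow> Inr f \<in> S" .
  qed
  have tT [simp]: "Inr (t v) \<in> T" if "v \<in> ?B" for v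
    using that by (auto simp: T_def)
  \<comment> \<open>As \<open>x mod 0 = x\<close>, the case \<open>p = 0\<close> is separate; there
    \<open>g v\<close> would lie in the empty set.\<close>
  have p: "g v mod p < p" if "v \<in> ?B" for v
    using bij_betwE[OF g] that by (cases "p = 0") auto
  have S_GA: "(\<exists>v \<in> A. x = Inl v) \<or> (\<exists>e \<in> edges G. e \<subseteq> A \<and> x = Inr e)" if "x \<in> S" for x
    using that dom by (auto simp: middle_graph_def induced_subgraph_def)
  have "T \<subseteq> verts (middle_graph ?J)"
  proof
    fix x assume "x \<in> T"
    then consider (v) y v where "y \<in> S" "x = lift y" "v \<in> A" "y = Inl v"
      | (e) y e where "y \<in> S" "x = lift y" "e \<in> edges G" "y = Inr e"
      | (t) v where "v \<in> ?B" "x = Inr (t v)"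
      using S_GA unfolding T_def by blast
    then show "x \<in> verts (middle_graph ?J)"
    proof cases
      case v
      then show ?thesis using A(1) by (auto simp: lift_def graph_join_def)
    next
      case e
      then show ?thesis by (simp add: lift_def graph_join_def)
    next
      case t
      then show ?thesis using p[of v] by (auto simp: t_def graph_join_def edgeless_graph_def)
    qed
  qed
  moreover have covA: "\<exists>f. Inr f \<in> S \<and> v \<in> f" if "v \<in> A" for v
    using dom that by (simp add: induced_subgraph_def)
  have covR: "\<exists>v \<in> ?B. \<exists>v' \<in> ?B. v \<noteq> v' \<and> Inr i \<in> t v \<and> Inr i \<in> t v'" if "i < p" for i
  proof -
    have "i \<in> g ` ?B" "i + p \<in> g ` ?B"
      using g that by (auto simp: bij_betw_def)
    then obtain v v' where "v \<in> ?B" "v' \<in> ?B" "g v = i" "g v' = i + p"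
      by (metis imageE)
    moreover have "v \<noteq> v'"
      using calculation that by auto
    ultimately show ?thesis
      using that by (intro bexI[of _ v] bexI[of _ v']) (auto simp: t_def)
  qed
  have "\<exists>f. Inr f \<in> T \<and> x \<in> f" if x: "x \<in> verts ?J" for x
  proof -
    consider (A) v where "x = Inl v" "v \<in> A" | (B) v where "x = Inl v" "v \<in> ?B"
      | (R) i where "x = Inr i" "i < p"
      using x by (auto simp: graph_join_def edgeless_graph_def)
    then show ?thesis
    proof cases
      case A
      with covA obtain f where "Inr f \<in> S" "v \<in> f" by blast
      with A show ?thesis by (intro exI[of _ "Inl ` f"]) auto
    next
      case B
      moreover have "Inl v \<in> t v" by (simp add: t_def)
      ultimately show ?thesis using tT by blast
    next
      case R
      with covR obtain v where "v \<in> ?B" "Inr i \<in> t v" by blast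
      with R tT show ?thesis by blast
    qed
  qed
  moreover have "(\<exists>x \<in> e. Inl x \<in> T) \<or> (\<exists>f. Inr f \<in> T \<and> f \<noteq> e \<and> f \<inter> e \<noteq> {})"
    if e: "e \<in> edges ?J" for e
  proof -
    \<comment> \<open>\<open>e\<close> can equal at most one of the two distinct added edges at
      \<open>i\<close>; the other one dominates it.\<close>
    have R: ?thesis if "Inr i \<in> e" "i < p" for i
    proof -
      obtain v v' where v: "v \<in> ?B" "v' \<in> ?B" "v \<noteq> v'" "Inr i \<in> t v" "Inr i \<in> t v'"
        using covR[OF \<open>i < p\<close>] by blast
      then have "t v \<noteq> t v'"
        by (auto simp: t_def doubleton_eq_iff)
      then show ?thesis
        using v that tT by (metis disjoint_iff)
    qed
    consider (G) d where "d \<in> edges G" "e = Inl ` d"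
      | (j) v i where "i < p" "e = {Inl v, Inr i}"
      using e by (auto simp: graph_join_def edgeless_graph_def)
    then show ?thesis
    proof cases
      case j
      then show ?thesis using R by blast
    next
      case G
      have d: "d \<subseteq> verts G" "card d = 2"
        using G assms(1) unfolding simple_graph_def by auto
      show ?thesis
      proof (cases "d \<subseteq> A")
        case True
        then have "(\<exists>v \<in> d. Inl v \<in> S) \<or> (\<exists>f. Inr f \<in> S \<and> f \<noteq> d \<and> f \<inter> d \<noteq> {})"
          using dom G by (simp add: induced_subgraph_def)
        then show ?thesis
        proof
          assume "\<exists>v \<in> d. Inl v \<in> S"
          then show ?thesis using G by auto
        next
          assume "\<exists>f. Inr f \<in> S \<and> f \<noteq> d \<and> f \<inter> d \<noteq> {}"
          then obtain f where "Inr f \<in> S" "f \<noteq> d" "f \<inter> d \<noteq> {}" by blast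
          then have "Inr (Inl ` f) \<in> T \<and> Inl ` f \<noteq> e \<and> Inl ` f \<inter> e \<noteq> {}"
            using G by (auto simp: inj_image_eq_iff)
          then show ?thesis by blast
        qed
      next
        case False
        then obtain v where v: "v \<in> d" "v \<in> ?B"
          using d by blast
        \<comment> \<open>Both contain \<open>Inl v\<close>, but only \<open>t v\<close> contains a
          new vertex.\<close>
        then have "t v \<noteq> e" "t v \<inter> e \<noteq> {}"
          using G by (auto simp: t_def)
        then show ?thesis
          using v tT by blast
      qed
    qed
  qed
  ultimately have "total_dominating_set (middle_graph ?J) T"
    unfolding total_dominating_set_middle_graph_iff[OF J] by blast
  then have "total_domination_number (middle_graph ?J) \<le> card T"
    by (rule total_domination_number_le[OF simple_graph_middle_graph[OF J]])
  also have "card T \<le> card S + card ?B"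
  proof -
    have "finite S"
      using dom simple_graph_middle_graph[OF GA] finite_subset unfolding simple_graph_def by blast
    then show ?thesis
      unfolding T_def by (intro order_trans[OF card_Un_le add_mono] card_image_le finB)
  qed
  finally show ?thesis
    using cardS B by simp
qed

theorem theorem4p10:
  fixes G :: "'a graph" and n p :: nat
  assumes "simple_graph G"
    and "connected_graph G"
    and "card (verts G) = n"
    and "n \<ge> 2"
    and "1 \<le> p"
    and "real p \<le> real n / 2 - 1"
  shows "\<lceil>2 * (real n + real p) / 3\<rceil>
           \<le> int (total_domination_number (middle_graph (graph_join G (edgeless_graph p))))
       \<and> total_domination_number (middle_graph (graph_join G (edgeless_graph p)))
           \<le> 2 * p + Min {total_domination_number (middle_graph (induced_subgraph G A)) | A.
                 A \<subseteq> verts G \<and> card A = n - 2 * p \<and> no_isolated_vertices (induced_subgraph G A)}"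
proof
  let ?J = "graph_join G (edgeless_graph p)"
  have J: "simple_graph ?J"
    using simple_graph_join[OF assms(1) simple_graph_edgeless] .
  have fin: "finite (verts G)"
    using assms(1) unfolding simple_graph_def by blast
  \<comment> \<open>This keeps the natural subtraction \<open>n - 2 * p\<close> exact and makes it
    at least 2, the least size for which a suitable \<open>A\<close> is constructed.\<close>
  have n: "2 * p + 2 \<le> n"
    using assms(6) by linarith
  have "no_isolated_vertices ?J"
    using assms by (intro no_isolated_vertices_graph_join) (auto simp: edgeless_graph_def lessThan_empty_iff)
  then obtain S where "total_dominating_set (middle_graph ?J) S"
    and S: "card S = total_domination_number (middle_graph ?J)"
    using total_domination_number_attained[OF simple_graph_middle_graph[OF J]]
      no_isolated_vertices_middle_graph[OF J] by blast
  then have "2 * card (verts ?J) \<le> 3 * card S"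
    using card_total_dominating_set_middle_graph_ge[OF J] by blast
  moreover have "card (verts ?J) = n + p"
    using card_verts_graph_join[of G "edgeless_graph p"] fin assms(3) by (simp add: edgeless_graph_def)
  ultimately have "2 * (n + p) \<le> 3 * card S"
    by simp
  then have "real (2 * (n + p)) \<le> real (3 * card S)"
    by (simp only: of_nat_le_iff)
  then have "2 * (real n + real p) / 3 \<le> real (card S)"
    by simp
  \<comment> \<open>The right-hand side is an integer, so the real bound survives rounding
    up.\<close>
  then show "\<lceil>2 * (real n + real p) / 3\<rceil> \<le> int (total_domination_number (middle_graph ?J))"
    unfolding S by (simp add: ceiling_le_iff)
  let ?M = "{total_domination_number (middle_graph (induced_subgraph G A)) | A.
    A \<subseteq> verts G \<and> card A = n - 2 * p \<and> no_isolated_vertices (induced_subgraph G A)}"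
  \<comment> \<open>Finiteness and nonemptiness make \<open>Min ?M\<close> a genuine minimum,
    attained by some \<open>A\<close>; the construction is then applied to that
    \<open>A\<close>.\<close>
  have "finite ?M"
    using fin by (auto intro: finite_subset[of _
          "(\<lambda>A. total_domination_number (middle_graph (induced_subgraph G A))) ` Pow (verts G)"])
  moreover obtain A where "A \<subseteq> verts G" "card A = n - 2 * p"
    "no_isolated_vertices (induced_subgraph G A)"
    using connected_graph_subset_no_isolated[OF assms(1,2), of "n - 2 * p"] n assms(3) by force
  then have "?M \<noteq> {}"
    by blast
  ultimately have "Min ?M \<in> ?M"
    by (rule Min_in)
  then obtain A where A: "A \<subseteq> verts G" "card A = n - 2 * p"
    "no_isolated_vertices (induced_subgraph G A)"
    and Min: "Min ?M = total_domination_number (middle_graph (induced_subgraph G A))"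
    by blast
  have "card (verts G - A) = 2 * p"
    using A fin n assms(3) by (subst card_Diff_subset) (auto intro: finite_subset)
  then show "total_domination_number (middle_graph ?J) \<le> 2 * p + Min ?M"
    unfolding Min by (rule total_domination_number_join_edgeless_le[OF assms(1) A(1,3)])
qed

end
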